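(* Let $p$ be a symmetric nc polynomial of degree at least $3$ in $g$ symmetric variables whose Hessian has scalar middle matrix $\mathcal Z$ with $\mu_-(\mathcal Z)=1$, and let $u,y\in\mathbb{R}^g$ with $\|u\|=1$, $v\in\mathbb{R}^{g^2}$ with $(\mathrm{mat}_g v)u=0$, and $A=A^T\in\mathbb{R}^{g\times g}$ be such that $\mathcal Z_{ij}=0$ for $i+j\ge3$ and $$\mathcal Z_{01}=u(u^T\otimes y^T)+uv^T+(uv^T)^{sT},\quad \mathcal Z_{11}=(u\otimes I_g)A(u\otimes I_g)^T,\quad \mathcal Z_{02}=u(u^T\otimes(\mathrm{vec}\,A)^T),$$ with $$\begin{bmatrix}P\mathcal Z_{00}P&(\mathrm{mat}_g v)^T\\ \mathrm{mat}_g v&A\end{bmatrix}\succeq0,\qquad P=I_g-uu^T .$$ Then, with (1) $\varphi(x)=[x_1\ \cdots\ x_g]u$, (2) $q(x)=\frac14(u\otimes y+2v)^T([x_1\ \cdots\ x_g]_2)^T$, (3) $f_0(x)=\frac12[x_1\ \cdots\ x_g]A[x_1\ \cdots\ x_g]^T$, one has $$p(x)=p_0+p_1(x)+p_2(x)+\varphi(x)q(x)+q^T(x)\varphi(x)+\varphi(x)f_0(x)\varphi(x),$$ where $p_j$ is the homogeneous part of degree $j$ of $p$, and $$\begin{bmatrix}PQ(p_2)P&PQ(q)^T\\ Q(q)P&Q(f_0)\end{bmatrix}\succeq0 .$$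
   Context: An nc polynomial is an element of the free algebra $\mathbb{R}\langle x\rangle$ in noncommuting variables $x_1,\dots,x_g$ with real coefficients. The involution $T$ is the linear map with $x_j^T=x_j$ (and $h_j^T=h_j$) that reverses words; $p$ is symmetric if $p^T=p$. For a matrix of nc polynomials, $T$ transposes the matrix and applies the involution to each entry. $\otimes$ is the Kronecker product, $A\otimes B=[a_{ij}B]$. For $q=\sum_{i,j}q_{ij}x_ix_j$, $Q(q)=[q_{ij}]\in\mathbb{R}^{g\times g}$. $[x_1\cdots x_g]_j$ denotes the $j$-fold Kronecker product $[x_1\cdots x_g]\otimes\cdots\otimes[x_1\cdots x_g]$, the row of all words of length $j$ in lexicographic order. In particular $([x_1\cdots x_g]_2)^T$ is the column whose $(i,j)$ entry (lexicographic order) is $(x_ix_j)^T=x_jx_i$. Border vectors: $V_0^T=[h_1\cdots h_g]$ and $V_j^T=[x_1\cdots x_g]_j\otimes[h_1\cdots h_g]$ for $j\ge1$; $V_j=V_j(x)[h]$ has height $g^{j+1}$. The Hessian $p''(x)[h]=\frac{d^2}{dt^2}p(x+th)|_{t=0}$ of a symmetric nc polynomial of degree $d\ge2$ has a unique representation $p''(x)[h]=\sum_{i,j=0}^{d-2}V_i^TZ_{ij}(x)V_j$ with $Z_{ij}(x)$ a $g^{i+1}\times g^{j+1}$ matrix of nc polynomials in $x$ ($Z_{ij}=0$ if $i+j>d-2$). The scalar middle matrix is $\mathcal Z=[\mathcal Z_{ij}]$ with $\mathcal Z_{ij}=Z_{ij}(0)$, a real symmetric matrix (blocks with $i+j>d-2$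 are zero); $\mu_-(\mathcal Z)$ is its number of negative eigenvalues. A $g\times g^2$ matrix $C$ is viewed as a $g\times g$ block matrix $[c_{ij}]$ with $c_{ij}\in\mathbb{R}^{1\times g}$; its structured transpose $C^{sT}$ has $ij$ block $c_{ji}$. $\mathrm{vec}$ stacks the columns of a matrix with $g$ rows; $\mathrm{mat}_g$ is its inverse, sending a vector in $\mathbb{R}^{gn}$ with stacked subvectors $a_1,\dots,a_n\in\mathbb{R}^g$ to $[a_1\ \cdots\ a_n]$. *)

theory Defs
  imports
    "HOL-Analysis.Derivative"
    "HOL-Library.Poly_Mapping"
    "Jordan_Normal_Form.Char_Poly"
begin

section \<open>Noncommutative polynomials\<close>

text \<open>The words form the free monoid. It is written additively because the product on
  \<open>\<Rightarrow>\<^sub>0\<close> from \<open>HOL-Library.Poly_Mapping\<close> is the convolution over an additive monoid of keys.\<close>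

datatype 'a ncword = NCWord (letters: "'a list")

instantiation ncword :: (type) monoid_add
begin
definition zero_ncword :: "'a ncword" where "0 = NCWord []"
definition plus_ncword :: "'a ncword \<Rightarrow> 'a ncword \<Rightarrow> 'a ncword"
  where "v + w = NCWord (letters v @ letters w)"
instance by standard (simp_all add: zero_ncword_def plus_ncword_def)
end

text \<open>\<open>X i\<close> and \<open>H i\<close> stand for $x_{i+1}$ and $h_{i+1}$: all indices start at 0.\<close>

datatype letter = X nat | H nat

type_synonym ncpoly = "letter ncword \<Rightarrow>\<^sub>0 real"

definition nc_coeff :: "ncpoly \<Rightarrow> letter list \<Rightarrow> real"
  where "nc_coeff p w = Poly_Mapping.lookup p (NCWord w)"

definition nc_const :: "real \<Rightarrow> ncpoly"
  where "nc_const c = Poly_Mapping.single 0 c"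

definition nc_var :: "letter \<Rightarrow> ncpoly"
  where "nc_var l = Poly_Mapping.single (NCWord [l]) 1"

text \<open>The polynomials in the variables $x_1, \dots, x_g$ only.\<close>

definition nc_in_x :: "nat \<Rightarrow> ncpoly set"
  where "nc_in_x g = {p. \<forall>w \<in> Poly_Mapping.keys p. set (letters w) \<subseteq> X ` {..<g}}"

definition nc_degree :: "ncpoly \<Rightarrow> nat"
  where "nc_degree p = Max (insert 0 ((\<lambda>w. length (letters w)) ` Poly_Mapping.keys p))"

definition nc_hom_part :: "nat \<Rightarrow> ncpoly \<Rightarrow> ncpoly"
  where "nc_hom_part j p =
    (\<Sum>w \<in> {w \<in> Poly_Mapping.keys p. length (letters w) = j}.
       Poly_Mapping.single w (Poly_Mapping.lookup p w))"

text \<open>The involution: each word is replaced by its reversal.\<close>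

definition nc_star :: "ncpoly \<Rightarrow> ncpoly"
  where "nc_star p = Poly_Mapping.map_key (\<lambda>w. NCWord (rev (letters w))) p"

text \<open>Evaluation at \<open>a\<close> in a ring containing the reals via \<open>emb\<close>.\<close>

definition nc_eval :: "(real \<Rightarrow> 'r::semiring_1) \<Rightarrow> (letter \<Rightarrow> 'r) \<Rightarrow> ncpoly \<Rightarrow> 'r"
  where "nc_eval emb a p =
    (\<Sum>w \<in> Poly_Mapping.keys p.
       emb (Poly_Mapping.lookup p w) * prod_list (map a (letters w)))"

definition nc_at_zero :: "ncpoly \<Rightarrow> real"
  where "nc_at_zero = nc_eval (\<lambda>c. c) (\<lambda>_. 0)"


section \<open>The Hessian\<close>

text \<open>The assignment for $p(x + th)$.\<close>

definition shift_letter :: "real \<Rightarrow> letter \<Rightarrow> ncpoly"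
  where "shift_letter t l =
    (case l of X i \<Rightarrow> nc_var (X i) + nc_const t * nc_var (H i) | H i \<Rightarrow> nc_var (H i))"

definition nc_shift :: "real \<Rightarrow> ncpoly \<Rightarrow> ncpoly"
  where "nc_shift t p = nc_eval nc_const (shift_letter t) p"

text \<open>The second derivative in \<open>t\<close> is taken coefficientwise; the lemma \<open>lookup_nc_hessian\<close> below
  shows that the result has finite support, so the abstraction function is applied in its
  domain.\<close>

definition nc_hessian :: "ncpoly \<Rightarrow> ncpoly"
  where "nc_hessian p =
    Abs_poly_mapping (\<lambda>w. (deriv ^^ 2) (\<lambda>t. Poly_Mapping.lookup (nc_shift t p) w) 0)"

lemma keys_shift_letter:
  "Poly_Mapping.keys (shift_letter t l) \<subseteq> (\<lambda>m. NCWord [m]) ` {X i |i. l = X i} \<union>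
     (\<lambda>m. NCWord [m]) ` {H i |i. l = X i \<or> l = H i}"
proof -
  have "Poly_Mapping.keys (nc_const t * nc_var (H i)) \<subseteq> {NCWord [H i]}" for i
    unfolding nc_const_def nc_var_def mult_single by (simp add: keys_single)
  moreover have "Poly_Mapping.keys (nc_var m) \<subseteq> {NCWord [m]}" for m
    unfolding nc_var_def by (simp add: keys_single)
  ultimately show ?thesis
    unfolding shift_letter_def using Poly_Mapping.keys_add
    by (cases l) (fastforce split: letter.splits)+
qed

lemma finite_shift_support:
  "\<exists>S. finite S \<and> (\<forall>t. Poly_Mapping.keys (prod_list (map (shift_letter t) ls)) \<subseteq> S)"
proof (induction ls)
  case Nil
  show ?case by (rule exI[of _ "{0}"]) simp
next
  case (Cons l ls)
  then obtain S where S: "finite S"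
    "\<And>t. Poly_Mapping.keys (prod_list (map (shift_letter t) ls)) \<subseteq> S" by blast
  define F where "F = (\<lambda>m. NCWord [m]) ` {X i |i. l = X i} \<union>
     (\<lambda>m. NCWord [m]) ` {H i |i. l = X i \<or> l = H i}"
  have "finite F" unfolding F_def by (cases l) auto
  have "Poly_Mapping.keys (prod_list (map (shift_letter t) (l # ls)))
      \<subseteq> (\<lambda>(a, b). a + b) ` (F \<times> S)" for t
    using keys_mult[of "shift_letter t l" "prod_list (map (shift_letter t) ls)"]
      keys_shift_letter[of t l, folded F_def] S(2)[of t] by fastforce
  with \<open>finite F\<close> S(1) show ?case
    by (intro exI[of _ "(\<lambda>(a, b). a + b) ` (F \<times> S)"]) auto
qed

lemma lookup_nc_hessian:
  "Poly_Mapping.lookup (nc_hessian p) w =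
     (deriv ^^ 2) (\<lambda>t. Poly_Mapping.lookup (nc_shift t p) w) 0"
proof -
  obtain S where S: "\<And>ls. finite (S ls)"
    "\<And>ls t. Poly_Mapping.keys (prod_list (map (shift_letter t) ls)) \<subseteq> S ls"
    using finite_shift_support by metis
  define U where "U = (\<Union>v \<in> Poly_Mapping.keys p. S (letters v))"
  have "finite U" unfolding U_def using S(1) by auto
  have out: "Poly_Mapping.lookup (nc_shift t p) w = 0" if "w \<notin> U" for t w
  proof -
    have "Poly_Mapping.keys (nc_shift t p) \<subseteq>
      (\<Union>v \<in> Poly_Mapping.keys p. Poly_Mapping.keys
         (nc_const (Poly_Mapping.lookup p v) * prod_list (map (shift_letter t) (letters v))))"
      unfolding nc_shift_def nc_eval_def by (rule Poly_Mapping.keys_sum)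
    also have "\<dots> \<subseteq> U"
    proof (unfold U_def, rule UN_mono[OF subset_refl])
      fix v
      have "Poly_Mapping.keys (nc_const c) \<subseteq> {0}" for c
        unfolding nc_const_def by (simp add: keys_single)
      then show "Poly_Mapping.keys (nc_const (Poly_Mapping.lookup p v) *
          prod_list (map (shift_letter t) (letters v))) \<subseteq> S (letters v)"
        using keys_mult[of "nc_const (Poly_Mapping.lookup p v)"
            "prod_list (map (shift_letter t) (letters v))"] S(2)[of t "letters v"]
        by fastforce
    qed
    finally show ?thesis using that by (auto simp: in_keys_iff)
  qed
  have "(deriv ^^ 2) (\<lambda>t. Poly_Mapping.lookup (nc_shift t p) w) 0 = 0" if "w \<notin> U" for w
    using out[OF that] by (simp add: numeral_2_eq_2)
  then have "{w. (deriv ^^ 2) (\<lambda>t. Poly_Mapping.lookup (nc_shift t p) w) 0 \<noteq> 0} \<subseteq> U"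
    by blast
  then have "finite {w. (deriv ^^ 2) (\<lambda>t. Poly_Mapping.lookup (nc_shift t p) w) 0 \<noteq> 0}"
    using \<open>finite U\<close> by (rule finite_subset)
  then show ?thesis unfolding nc_hessian_def by (simp add: lookup_Abs_poly_mapping)
qed


section \<open>Matrices\<close>

definition kron :: "'a::times mat \<Rightarrow> 'a mat \<Rightarrow> 'a mat"
  where "kron A B = mat (dim_row A * dim_row B) (dim_col A * dim_col B)
    (\<lambda>(i, j). A $$ (i div dim_row B, j div dim_col B) * B $$ (i mod dim_row B, j mod dim_col B))"

primrec kron_pow :: "'a::semiring_1 mat \<Rightarrow> nat \<Rightarrow> 'a mat"
  where
    "kron_pow M 0 = 1\<^sub>m 1"
  | "kron_pow M (Suc j) = kron (kron_pow M j) M"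

definition col_mat :: "'a vec \<Rightarrow> 'a mat"
  where "col_mat v = mat_of_cols (dim_vec v) [v]"

text \<open>The structured transpose of a $g \times g^2$ matrix, which consists of $g \times g$ blocks
  of size $1 \times g$.\<close>

definition struct_transpose :: "nat \<Rightarrow> 'a mat \<Rightarrow> 'a mat"
  where "struct_transpose g C = mat g (g\<^sup>2) (\<lambda>(i, m). C $$ (m div g, i * g + m mod g))"

definition vec_op :: "'a mat \<Rightarrow> 'a vec"
  where "vec_op A =
    vec (dim_row A * dim_col A) (\<lambda>k. A $$ (k mod dim_row A, k div dim_row A))"

definition mat_op :: "nat \<Rightarrow> 'a vec \<Rightarrow> 'a mat"
  where "mat_op g v = mat g (dim_vec v div g) (\<lambda>(i, j). v $ (j * g + i))"

definition psd :: "real mat \<Rightarrow> bool"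
  where "psd M \<longleftrightarrow> square_mat M \<and> transpose_mat M = M \<and>
    (\<forall>z \<in> carrier_vec (dim_row M). 0 \<le> scalar_prod z (M *\<^sub>v z))"

text \<open>The number of negative eigenvalues, counted with multiplicity.\<close>

definition mu_minus :: "real mat \<Rightarrow> nat"
  where "mu_minus M =
    (\<Sum>l \<in> {l. eigenvalue M l \<and> l < 0}. Polynomial.order l (char_poly M))"

text \<open>The counterpart for columns of the row concatenation \<open>@\<^sub>r\<close>.\<close>

definition append_cols :: "'a::zero mat \<Rightarrow> 'a mat \<Rightarrow> 'a mat"
  where "append_cols A B = four_block_mat A B (0\<^sub>m 0 (dim_col A)) (0\<^sub>m 0 (dim_col B))"

text \<open>The block matrix \<open>[B i j]\<close> with \<open>i, j < n\<close>, where \<open>B i j\<close> has \<open>r i\<close> rows and \<open>r j\<close>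
  columns.\<close>

definition block_mat :: "nat \<Rightarrow> (nat \<Rightarrow> nat) \<Rightarrow> (nat \<Rightarrow> nat \<Rightarrow> 'a::zero mat) \<Rightarrow> 'a mat"
  where "block_mat n r B =
    foldr (\<lambda>i M. foldr (\<lambda>j N. append_cols (B i j) N) [0..<n] (0\<^sub>m (r i) 0) @\<^sub>r M)
      [0..<n] (0\<^sub>m 0 (\<Sum>j<n. r j))"


section \<open>Border vectors and middle matrix\<close>

definition nc_mat :: "real mat \<Rightarrow> ncpoly mat"
  where "nc_mat M = map_mat nc_const M"

definition nc_adjoint :: "ncpoly mat \<Rightarrow> ncpoly mat"
  where "nc_adjoint M = map_mat nc_star (transpose_mat M)"

definition x_row :: "nat \<Rightarrow> ncpoly mat"
  where "x_row g = mat 1 g (\<lambda>(_, j). nc_var (X j))"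

definition h_row :: "nat \<Rightarrow> ncpoly mat"
  where "h_row g = mat 1 g (\<lambda>(_, j). nc_var (H j))"

text \<open>The row $V_j^T$ is \<open>border_row g j\<close>, and the column $V_j$ is its adjoint, whose entries are
  the reversed words.\<close>

definition border_row :: "nat \<Rightarrow> nat \<Rightarrow> ncpoly mat"
  where "border_row g j = kron (kron_pow (x_row g) j) (h_row g)"

definition border_col :: "nat \<Rightarrow> nat \<Rightarrow> ncpoly mat"
  where "border_col g j = nc_adjoint (border_row g j)"

text \<open>\<open>Z\<close> is the middle matrix of the Hessian of \<open>p\<close>. It is given as a family of blocks indexed
  by all pairs of naturals, so that $Z_{ij} = 0$ for $i + j > d - 2$ also covers blocks outside
  the range $i, j \le d - 2$ (such as $Z_{02}$ for $d = 3$). The monomials of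
  $V_i^T Z_{ij} V_j$ are $w h_k m h_l w'$ with $w, w'$ of length $i, j$, so \<open>Z\<close> is determined
  by \<open>p\<close>.\<close>

definition middle_matrix :: "nat \<Rightarrow> ncpoly \<Rightarrow> (nat \<Rightarrow> nat \<Rightarrow> ncpoly mat) \<Rightarrow> bool"
  where "middle_matrix g p Z \<longleftrightarrow>
    (\<forall>i j. Z i j \<in> carrier_mat (g ^ (i + 1)) (g ^ (j + 1)) \<and>
       elements_mat (Z i j) \<subseteq> nc_in_x g \<and>
       (i + j > nc_degree p - 2 \<longrightarrow> Z i j = 0\<^sub>m (g ^ (i + 1)) (g ^ (j + 1)))) \<and>
    nc_hessian p =
      (\<Sum>i\<le>nc_degree p - 2. \<Sum>j\<le>nc_degree p - 2.
         (border_row g i * Z i j * border_col g j) $$ (0, 0))"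

definition scalar_block :: "(nat \<Rightarrow> nat \<Rightarrow> ncpoly mat) \<Rightarrow> nat \<Rightarrow> nat \<Rightarrow> real mat"
  where "scalar_block Z i j = map_mat nc_at_zero (Z i j)"

definition scalar_middle_matrix ::
    "nat \<Rightarrow> nat \<Rightarrow> (nat \<Rightarrow> nat \<Rightarrow> ncpoly mat) \<Rightarrow> real mat"
  where "scalar_middle_matrix g d Z =
    block_mat (d - 1) (\<lambda>i. g ^ (i + 1)) (scalar_block Z)"

definition Q_mat :: "nat \<Rightarrow> ncpoly \<Rightarrow> real mat"
  where "Q_mat g q = mat g g (\<lambda>(i, j). nc_coeff q [X i, X j])"

end

theory Submission
  imports Defs
begin

text \<open>In the Hessian, a word with exactly two letters $h$ has twice the coefficient in $p$ of the
  word in which these letters are replaced by $x$. Hence the entry of $\mathcal Z_{ij}$ in row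
  $(w, k)$ and column $(w', l)$ is twice the coefficient of $w x_k x_l (w')^T$ in $p$, and the
  blocks with $i + j = n - 2$ determine the part of $p$ of degree $n$. So $p$ has degree at most
  4, $\mathcal Z_{01}$ gives its cubic part and $\mathcal Z_{11}$ its quartic part. The second
  matrix is half of the first, since $u^T P = 0$ and $(\mathrm{mat}_g v) u = 0$ give
  $Q(q) P = \mathrm{mat}_g v / 2$.\<close>

section \<open>Coefficients of products\<close>

lemma poly_mapping_eq_sum_single:
  "(p :: 'a \<Rightarrow>\<^sub>0 'b::comm_monoid_add) =
    (\<Sum>w \<in> Poly_Mapping.keys p. Poly_Mapping.single w (Poly_Mapping.lookup p w))"
  by (rule poly_mapping_eqI)
    (auto simp: lookup_sum lookup_single when_def in_keys_iff sum.delta')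

lemma plus_NCWord: "NCWord v + NCWord w = NCWord (v @ w)"
  by (simp add: plus_ncword_def)

text \<open>The free monoid is cancellative: only the key of \<open>q\<close> left over after
  removing the prefix \<open>v\<close> from \<open>w\<close> can contribute, so the convolution has
  at most one term.\<close>

lemma lookup_single_mult:
  fixes q :: "'a ncword \<Rightarrow>\<^sub>0 'b::semiring_0"
  shows "Poly_Mapping.lookup (Poly_Mapping.single (NCWord v) c * q) (NCWord w) =
    (if \<exists>m. w = v @ m then c * Poly_Mapping.lookup q (NCWord (drop (length v) w)) else 0)"
proof -
  have eq: "NCWord v + x = NCWord w \<longleftrightarrow> (\<exists>m. w = v @ m) \<and> x = NCWord (drop (length v) w)" for x
    by (cases x) (auto simp: plus_NCWord)
  have "Poly_Mapping.single (NCWord v) c * q =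
      (\<Sum>x \<in> Poly_Mapping.keys q. Poly_Mapping.single (NCWord v + x) (c * Poly_Mapping.lookup q x))"
    by (subst (1) poly_mapping_eq_sum_single[of q])
      (simp add: sum_distrib_left mult_single)
  then show ?thesis
    by (auto simp: lookup_sum lookup_single when_def eq sum.delta in_keys_iff)
qed

lemma lookup_mult_single:
  fixes q :: "'a ncword \<Rightarrow>\<^sub>0 'b::semiring_0"
  shows "Poly_Mapping.lookup (q * Poly_Mapping.single (NCWord v) c) (NCWord w) =
    (if \<exists>m. w = m @ v then Poly_Mapping.lookup q (NCWord (take (length w - length v) w)) * c else 0)"
proof -
  have eq: "x + NCWord v = NCWord w \<longleftrightarrow>
      (\<exists>m. w = m @ v) \<and> x = NCWord (take (length w - length v) w)" for x
    by (cases x) (auto simp: plus_NCWord)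
  have "q * Poly_Mapping.single (NCWord v) c =
      (\<Sum>x \<in> Poly_Mapping.keys q. Poly_Mapping.single (x + NCWord v) (Poly_Mapping.lookup q x * c))"
    by (subst (1) poly_mapping_eq_sum_single[of q])
      (simp add: sum_distrib_right mult_single)
  then show ?thesis
    by (auto simp: lookup_sum lookup_single when_def eq sum.delta in_keys_iff)
qed

lemma lookup_single_mult_single:
  fixes q :: "'a ncword \<Rightarrow>\<^sub>0 'b::semiring_0"
  shows "Poly_Mapping.lookup (Poly_Mapping.single (NCWord v) c * q * Poly_Mapping.single (NCWord w) d)
    (NCWord (v @ m @ w)) = c * Poly_Mapping.lookup q (NCWord m) * d"
  by (simp add: lookup_mult_single lookup_single_mult flip: append_assoc)

lemma lookup_single_mult_single_eq_0:
  fixes q :: "'a ncword \<Rightarrow>\<^sub>0 'b::semiring_0"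
  assumes "\<nexists>m. z = v @ m @ w"
  shows "Poly_Mapping.lookup (Poly_Mapping.single (NCWord v) c * q * Poly_Mapping.single (NCWord w) d)
    (NCWord z) = 0"
proof (cases "\<exists>m. z = m @ w")
  case True
  then obtain m where "z = m @ w" by blast
  with assms show ?thesis by (auto simp: lookup_mult_single lookup_single_mult)
qed (simp add: lookup_mult_single)

section \<open>Coefficients of the Hessian\<close>

text \<open>The words that arise when x + th is substituted into a word in x are exactly those that
  \<open>unmark\<close> sends back to it.\<close>

fun unmark :: "letter \<Rightarrow> letter"
  where "unmark (X i) = X i" | "unmark (H i) = X i"

definition h_degree :: "letter list \<Rightarrow> nat"
  where "h_degree w = length (filter (\<lambda>l. l \<in> range H) w)"

lemma shift_letter_X:
  "shift_letter t (X i) = Poly_Mapping.single (NCWord [X i]) 1 + Poly_Mapping.single (NCWord [H i]) t"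
  by (simp add: shift_letter_def nc_var_def nc_const_def mult_single)

text \<open>At each position the expansion chooses \<open>X i\<close> with factor 1 or
  \<open>H i\<close> with factor \<open>t\<close>. A word records all these choices, so it arises at
  most once, and each \<open>H\<close> in it adds one power of \<open>t\<close>.\<close>

lemma lookup_shift_word:
  assumes "set v \<subseteq> range X"
  shows "Poly_Mapping.lookup (prod_list (map (shift_letter t) v)) (NCWord w) =
    (if map unmark w = v then t ^ h_degree w else 0)"
  using assms
proof (induction v arbitrary: w)
  case Nil
  then show ?case
    by (auto simp: lookup_one zero_ncword_def h_degree_def when_def)
next
  case (Cons l v)
  then obtain i where [simp]: "l = X i" by auto
  have IH: "Poly_Mapping.lookup (prod_list (map (shift_letter t) v)) (NCWord w) =
      (if map unmark w = v then t ^ h_degree w else 0)" for w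
    using Cons by auto
  show ?case
  proof (cases w)
    case Nil
    then show ?thesis
      by (simp add: shift_letter_X distrib_right lookup_add lookup_single_mult)
  next
    case (Cons m w')
    then show ?thesis
      by (cases m) (auto simp: shift_letter_X distrib_right lookup_add lookup_single_mult IH h_degree_def)
  qed
qed

lemma lookup_nc_shift:
  assumes "p \<in> nc_in_x g"
  shows "Poly_Mapping.lookup (nc_shift t p) (NCWord w) = nc_coeff p (map unmark w) * t ^ h_degree w"
proof -
  have "Poly_Mapping.lookup (nc_shift t p) (NCWord w) = (\<Sum>v \<in> Poly_Mapping.keys p.
      if map unmark w = letters v then Poly_Mapping.lookup p v * t ^ h_degree w else 0)"
    unfolding nc_shift_def nc_eval_def lookup_sum
  proof (rule sum.cong[OF refl])
    fix v assume v: "v \<in> Poly_Mapping.keys p"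
    then have "set (letters v) \<subseteq> range X"
      using assms unfolding nc_in_x_def by blast
    then show "Poly_Mapping.lookup (nc_const (Poly_Mapping.lookup p v) *
        prod_list (map (shift_letter t) (letters v))) (NCWord w) =
      (if map unmark w = letters v then Poly_Mapping.lookup p v * t ^ h_degree w else 0)"
      by (simp add: nc_const_def zero_ncword_def lookup_single_mult lookup_shift_word)
  qed
  also have "\<dots> = (\<Sum>v \<in> Poly_Mapping.keys p.
      if v = NCWord (map unmark w) then Poly_Mapping.lookup p v * t ^ h_degree w else 0)"
    by (rule sum.cong) (auto simp: ncword.expand)
  also have "\<dots> = nc_coeff p (map unmark w) * t ^ h_degree w"
    by (auto simp: sum.delta nc_coeff_def in_keys_iff)
  finally show ?thesis .
qed

text \<open>The coefficient of \<open>w\<close> in p(x + th) is a constant times t^2; the factor 2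
  comes from differentiating twice.\<close>

lemma lookup_nc_hessian_h_degree_2:
  assumes "p \<in> nc_in_x g" "h_degree w = 2"
  shows "Poly_Mapping.lookup (nc_hessian p) (NCWord w) = 2 * nc_coeff p (map unmark w)"
proof -
  have "deriv (\<lambda>t::real. c * t\<^sup>2) = (\<lambda>t. 2 * c * t)" for c
    by (rule ext, rule DERIV_imp_deriv) (auto intro!: derivative_eq_intros)
  moreover have "deriv (\<lambda>t::real. 2 * c * t) 0 = 2 * c" for c
    by (rule DERIV_imp_deriv) (auto intro!: derivative_eq_intros)
  ultimately show ?thesis
    by (simp add: lookup_nc_hessian lookup_nc_shift[OF assms(1)] assms(2) eval_nat_numeral(2))
qed

section \<open>Border vectors\<close>

text \<open>For \<open>a < g ^ j\<close> the letters are the base \<open>g\<close> digits of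
  \<open>a\<close>, most significant first. This is the lexicographic order in which
  \<open>kron\<close> lists the words.\<close>

primrec x_word :: "nat \<Rightarrow> nat \<Rightarrow> nat \<Rightarrow> letter list"
  where
    "x_word g 0 a = []"
  | "x_word g (Suc j) a = x_word g j (a div g) @ [X (a mod g)]"

text \<open>The word at position \<open>a\<close> of the row V_j^T: the last digit of
  \<open>a\<close> is the index of h.\<close>

definition border_word :: "nat \<Rightarrow> nat \<Rightarrow> nat \<Rightarrow> letter list"
  where "border_word g j a = x_word g j (a div g) @ [H (a mod g)]"

lemma x_row_carrier: "x_row g \<in> carrier_mat 1 g"
  by (simp add: x_row_def)

lemma x_row_entry: "a < g \<Longrightarrow> x_row g $$ (0, a) = Poly_Mapping.single (NCWord [X a]) 1"
  by (simp add: x_row_def nc_var_def)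

lemma kron_pow_x_row_carrier: "kron_pow (x_row g) j \<in> carrier_mat 1 (g ^ j)"
  by (induction j) (auto simp: kron_def x_row_def mult.commute)

lemma kron_pow_x_row:
  "a < g ^ j \<Longrightarrow> kron_pow (x_row g) j $$ (0, a) = Poly_Mapping.single (NCWord (x_word g j a)) 1"
proof (induction j arbitrary: a)
  case 0
  then show ?case by (simp flip: zero_ncword_def)
next
  case (Suc j)
  \<comment> \<open>There is no index \<open>a\<close> when \<open>g = 0\<close>; positivity makes
    the last digit \<open>a mod g\<close> a valid column of \<open>x_row g\<close>.\<close>
  have "0 < g" using Suc.prems by (cases g) auto
  have "a div g < g ^ j" using Suc.prems
    by (simp add: less_mult_imp_div_less mult.commute)
  then show ?case
    using Suc.prems kron_pow_x_row_carrier[of g j] x_row_carrier[of g] \<open>0 < g\<close>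
    by (simp add: kron_def Suc.IH x_row_entry mult_single plus_NCWord mult.commute)
qed

lemma border_row_carrier: "border_row g j \<in> carrier_mat 1 (g ^ (j + 1))"
  using kron_pow_x_row_carrier[of g j] by (auto simp: border_row_def kron_def h_row_def mult.commute)

lemma border_row:
  assumes "a < g ^ (j + 1)"
  shows "border_row g j $$ (0, a) = Poly_Mapping.single (NCWord (border_word g j a)) 1"
proof -
  have "0 < g" using assms by (cases g) auto
  have "a div g < g ^ j" using assms
    by (simp add: less_mult_imp_div_less mult.commute)
  then show ?thesis
    using assms kron_pow_x_row_carrier[of g j] \<open>0 < g\<close>
    by (simp add: border_row_def kron_def h_row_def kron_pow_x_row nc_var_def mult_single
        plus_NCWord mult.commute border_word_def)
qed

lemma lookup_nc_star:
  "Poly_Mapping.lookup (nc_star q) (NCWord w) = Poly_Mapping.lookup q (NCWord (rev w))"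
proof -
  \<comment> \<open>\<open>map_key\<close> is composition with the key map only when that map is
    injective.\<close>
  have "inj (\<lambda>w :: letter ncword. NCWord (rev (letters w)))"
    by (rule injI) (simp add: ncword.expand)
  then show ?thesis
    by (simp add: nc_star_def map_key.rep_eq)
qed

lemma nc_star_single: "nc_star (Poly_Mapping.single (NCWord w) c) = Poly_Mapping.single (NCWord (rev w)) c"
proof (rule poly_mapping_eqI)
  show "Poly_Mapping.lookup (nc_star (Poly_Mapping.single (NCWord w) c)) k =
      Poly_Mapping.lookup (Poly_Mapping.single (NCWord (rev w)) c) k" for k
    by (cases k) (auto simp: lookup_nc_star lookup_single when_def)
qed

lemma border_col_carrier: "border_col g j \<in> carrier_mat (g ^ (j + 1)) 1"
  using border_row_carrier[of g j] by (auto simp: border_col_def nc_adjoint_def)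

lemma border_col:
  assumes "a < g ^ (j + 1)"
  shows "border_col g j $$ (a, 0) = Poly_Mapping.single (NCWord (rev (border_word g j a))) 1"
  using assms border_row_carrier[of g j]
  by (auto simp: border_col_def nc_adjoint_def border_row nc_star_single)

section \<open>Recovering positions and blocks from words\<close>

lemma length_x_word: "length (x_word g j a) = j"
  by (induction j arbitrary: a) auto

lemma set_x_word: "set (x_word g j a) \<subseteq> range X"
  by (induction j arbitrary: a) auto

text \<open>Digits determine the number: the last letter gives \<open>a mod g\<close>, and the
  remaining letters give \<open>a div g\<close> by induction.\<close>

lemma x_word_inject:
  "a < g ^ j \<Longrightarrow> b < g ^ j \<Longrightarrow> x_word g j a = x_word g j b \<Longrightarrow> a = b"
proof (induction j arbitrary: a b)
  case (Suc j)
  then have "a div g = b div g" "a mod g = b mod g"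
    by (auto simp: less_mult_imp_div_less mult.commute)
  then show ?case by (metis div_mult_mod_eq)
qed simp

lemma border_word_inject:
  "a < g ^ (j + 1) \<Longrightarrow> b < g ^ (j + 1) \<Longrightarrow> border_word g j a = border_word g j b \<Longrightarrow> a = b"
proof -
  assume *: "a < g ^ (j + 1)" "b < g ^ (j + 1)" "border_word g j a = border_word g j b"
  then have "a div g < g ^ j" "b div g < g ^ j"
    by (auto simp: less_mult_imp_div_less mult.commute)
  then have "a div g = b div g" "a mod g = b mod g"
    using * x_word_inject[of "a div g" g j "b div g"] by (auto simp: border_word_def)
  then show ?thesis by (metis div_mult_mod_eq)
qed

lemma length_border_word: "length (border_word g j a) = j + 1"
  by (simp add: border_word_def length_x_word)

text \<open>The \<open>H\<close> that closes the border word is its first letter outside the range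
  of \<open>X\<close>, so the x part can be read off whatever follows.\<close>

lemma takeWhile_border_word:
  "takeWhile (\<lambda>l. l \<in> range X) (border_word g j a @ w) = x_word g j (a div g)"
  using set_x_word[of g j "a div g"] unfolding border_word_def
  by (subst append_assoc, subst takeWhile_append2) auto

text \<open>The letters \<open>H\<close> mark where the middle part begins and ends, so a monomial of
  $V_i^T Z_{ij} V_j$ determines its block and its position in the block.\<close>

lemma border_word_middle_unique:
  assumes eq: "border_word g i a @ m @ rev (border_word g j b) =
      border_word g i' a' @ m' @ rev (border_word g j' b')"
    and "a < g ^ (i + 1)" "a' < g ^ (i' + 1)" "b < g ^ (j + 1)" "b' < g ^ (j' + 1)"
  shows "i = i' \<and> a = a' \<and> j = j' \<and> b = b' \<and> m = m'"
proof -
  have "x_word g i (a div g) = x_word g i' (a' div g)"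
    using arg_cong[OF eq, of "takeWhile (\<lambda>l. l \<in> range X)"]
    by (simp only: takeWhile_border_word)
  then have i: "i = i'" by (metis length_x_word)
  \<comment> \<open>The reversed monomial starts with the right border word, so the same argument
    yields \<open>j\<close>.\<close>
  have "x_word g j (b div g) = x_word g j' (b' div g)"
    using arg_cong[OF arg_cong[OF eq, of rev], of "takeWhile (\<lambda>l. l \<in> range X)"]
    by (simp only: rev_append rev_rev_ident append_assoc takeWhile_border_word)
  then have j: "j = j'" by (metis length_x_word)
  from eq i have *: "border_word g i a = border_word g i a'"
    "m @ rev (border_word g j b) = m' @ rev (border_word g j' b')"
    by (auto simp: length_border_word)
  then have "m = m'" "border_word g j b = border_word g j b'"
    using j by (auto simp: length_border_word)
  then show ?thesis
    using i j * assms(2-) border_word_inject by blast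
qed

section \<open>Coefficients of a block between border vectors\<close>

lemma sandwich_entry:
  assumes "R \<in> carrier_mat 1 m" "M \<in> carrier_mat m n" "C \<in> carrier_mat n 1"
  shows "(R * M * C) $$ (0, 0) = (\<Sum>b<n. \<Sum>a<m. R $$ (0, a) * M $$ (a, b) * C $$ (b, 0))"
  using assms by (subst index_mult_mat)
    (auto simp: scalar_prod_def sum_distrib_right atLeast0LessThan mult.assoc)

text \<open>Every nonempty word vanishes at 0, while the empty product is 1.\<close>

lemma nc_at_zero_eq: "nc_at_zero q = nc_coeff q []"
proof -
  have z: "prod_list (map (\<lambda>_. 0::real) w) = (if w = [] then 1 else 0)" for w :: "letter list"
    by (cases w) auto
  have "nc_at_zero q = (\<Sum>w \<in> Poly_Mapping.keys q. if w = NCWord [] then Poly_Mapping.lookup q w else 0)"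
    unfolding nc_at_zero_def nc_eval_def z
    by (rule sum.cong) (auto simp: ncword.expand)
  then show ?thesis by (auto simp: sum.delta nc_coeff_def in_keys_iff)
qed

text \<open>A word with its two letters h adjacent has an empty middle part. By uniqueness of the
  decomposition it can therefore only meet the constant term of the one entry at its own
  position.\<close>

lemma lookup_border_sandwich:
  assumes "a < g ^ (i + 1)" "b < g ^ (j + 1)" "a' < g ^ (i' + 1)" "b' < g ^ (j' + 1)"
  shows "Poly_Mapping.lookup (Poly_Mapping.single (NCWord (border_word g i' a')) 1 * q *
      Poly_Mapping.single (NCWord (rev (border_word g j' b'))) 1)
      (NCWord (border_word g i a @ rev (border_word g j b))) =
    (if i' = i \<and> a' = a \<and> j' = j \<and> b' = b then nc_coeff q [] else 0)"
proof (cases "\<exists>m. border_word g i a @ rev (border_word g j b) =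
    border_word g i' a' @ m @ rev (border_word g j' b')")
  case True
  then obtain m where m: "border_word g i a @ [] @ rev (border_word g j b) =
    border_word g i' a' @ m @ rev (border_word g j' b')" by auto
  have *: "i = i' \<and> a = a' \<and> j = j' \<and> b = b' \<and> [] = m"
    using border_word_middle_unique[OF m] assms by blast
  then show ?thesis
    using lookup_single_mult_single[of "border_word g i' a'" 1 q "rev (border_word g j' b')" 1 "[]"]
    by (simp add: nc_coeff_def)
next
  case False
  \<comment> \<open>If all indices agreed, the empty word would be a middle part.\<close>
  then have "\<not> (i' = i \<and> a' = a \<and> j' = j \<and> b' = b)" by (metis append_Nil)
  then show ?thesis
    using lookup_single_mult_single_eq_0[OF False] by (simp only: if_False)
qed

lemma unmark_x_word: "map unmark (x_word g j a) = x_word g j a"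
  by (induction j arbitrary: a) auto

lemma h_degree_append: "h_degree (v @ w) = h_degree v + h_degree w"
  by (simp add: h_degree_def)

lemma h_degree_rev: "h_degree (rev w) = h_degree w"
  by (simp add: h_degree_def flip: rev_filter)

lemma h_degree_border_word: "h_degree (border_word g j a) = 1"
proof -
  have "h_degree (x_word g j b) = 0" for b
    using set_x_word[of g j b] by (auto simp: h_degree_def filter_empty_conv)
  then show ?thesis by (simp add: border_word_def h_degree_append) (simp add: h_degree_def)
qed

section \<open>Entries of the scalar middle matrix\<close>

lemma nc_coeff_eq_0_of_nc_degree_less:
  assumes "nc_degree p < length w"
  shows "nc_coeff p w = 0"
proof (rule ccontr)
  assume "nc_coeff p w \<noteq> 0"
  then have "NCWord w \<in> Poly_Mapping.keys p" by (simp add: nc_coeff_def in_keys_iff)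
  then have "length w \<in> (\<lambda>w. length (letters w)) ` Poly_Mapping.keys p" by force
  then have "length w \<le> nc_degree p" unfolding nc_degree_def by (intro Max_ge) auto
  with assms show False by simp
qed

lemma sum_eq_single:
  assumes "finite A" "x \<in> A" "\<And>y. y \<in> A \<Longrightarrow> y \<noteq> x \<Longrightarrow> f y = 0"
  shows "sum f A = f x"
  using assms by (simp add: sum.remove)

text \<open>One coefficient of the Hessian is computed in two ways: from p(x + th) it is twice a
  coefficient of \<open>p\<close>, and from the middle matrix it is the constant term of a single
  entry of a single block.\<close>

lemma scalar_block_entry:
  assumes p: "p \<in> nc_in_x g" and Z: "middle_matrix g p Z"
    and a: "a < g ^ (i + 1)" and b: "b < g ^ (j + 1)"
  shows "scalar_block Z i j $$ (a, b) =
    2 * nc_coeff p (map unmark (border_word g i a @ rev (border_word g j b)))"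
proof -
  have carrier: "Z i j \<in> carrier_mat (g ^ (i + 1)) (g ^ (j + 1))" for i j
    using Z by (simp add: middle_matrix_def)
  have block: "scalar_block Z i j $$ (a, b) = nc_coeff (Z i j $$ (a, b)) []"
    using carrier[of i j] a b by (simp add: scalar_block_def nc_at_zero_eq)
  show ?thesis
  proof (cases "i + j \<le> nc_degree p - 2")
    case True
    let ?d = "nc_degree p - 2" and ?w = "NCWord (border_word g i a @ rev (border_word g j b))"
    define c where "c i' j' b' a' = Poly_Mapping.lookup (border_row g i' $$ (0, a') * Z i' j' $$ (a', b') *
        border_col g j' $$ (b', 0)) ?w" for i' j' b' a'
    have c: "c i' j' b' a' = (if i' = i \<and> a' = a \<and> j' = j \<and> b' = b then nc_coeff (Z i' j' $$ (a', b')) [] else 0)"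
      if "a' < g ^ (i' + 1)" "b' < g ^ (j' + 1)" for i' j' b' a'
      unfolding c_def border_row[OF that(1)] border_col[OF that(2)]
      by (rule lookup_border_sandwich[OF a b that])
    have "Poly_Mapping.lookup (nc_hessian p) ?w =
        (\<Sum>i'\<le>?d. \<Sum>j'\<le>?d. \<Sum>b'<g ^ (j' + 1). \<Sum>a'<g ^ (i' + 1). c i' j' b' a')"
      using Z unfolding middle_matrix_def c_def
      by (simp only: sandwich_entry[OF border_row_carrier carrier border_col_carrier] lookup_sum)
    \<comment> \<open>By \<open>c\<close> only one quadruple of indices contributes, so the four
      sums collapse one after the other, from the outside inwards.\<close>
    also have "\<dots> = (\<Sum>j'\<le>?d. \<Sum>b'<g ^ (j' + 1). \<Sum>a'<g ^ (i + 1). c i j' b' a')"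
      using True by (intro sum_eq_single sum.neutral ballI) (auto simp: c)
    also have "\<dots> = (\<Sum>b'<g ^ (j + 1). \<Sum>a'<g ^ (i + 1). c i j b' a')"
      using True by (intro sum_eq_single sum.neutral ballI) (auto simp: c)
    also have "\<dots> = (\<Sum>a'<g ^ (i + 1). c i j b a')"
      using b by (intro sum_eq_single sum.neutral ballI) (auto simp: c)
    also have "\<dots> = c i j b a"
      using a b by (intro sum_eq_single sum.neutral ballI) (auto simp: c)
    also have "\<dots> = nc_coeff (Z i j $$ (a, b)) []"
      using a b by (simp add: c)
    finally show ?thesis
      using lookup_nc_hessian_h_degree_2[OF p, of "border_word g i a @ rev (border_word g j b)"]
      by (simp add: block h_degree_append h_degree_rev h_degree_border_word)
  next
    \<comment> \<open>Outside the range both sides vanish: the block is zero by convention, and the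
      word has length \<open>i + j + 2\<close>, which exceeds the degree.\<close>
    case False
    then have "Z i j = 0\<^sub>m (g ^ (i + 1)) (g ^ (j + 1))"
      using Z by (simp add: middle_matrix_def)
    moreover have "nc_coeff p (map unmark (border_word g i a @ rev (border_word g j b))) = 0"
      using False by (intro nc_coeff_eq_0_of_nc_degree_less) (simp add: length_border_word)
    ultimately show ?thesis
      using a b by (simp add: block nc_coeff_def)
  qed
qed

section \<open>Vanishing of a homogeneous part\<close>

lemma mult_add_less_mult:
  fixes j :: nat
  assumes "j < m" "i < n"
  shows "j * n + i < m * n"
proof -
  have "j * n + i < Suc j * n" using assms(2) by simp
  also have "\<dots> \<le> m * n" using assms(1) by (intro mult_le_mono1) simp
  finally show ?thesis .
qed

text \<open>Horner's scheme: appending \<open>X k\<close> to the word at position \<open>a\<close>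
  leads to position \<open>a * g + k\<close>.\<close>

lemma x_word_surj:
  "set w \<subseteq> X ` {..<g} \<Longrightarrow> \<exists>a < g ^ length w. x_word g (length w) a = w"
proof (induction w rule: rev_induct)
  case (snoc l w)
  then obtain a k where a: "a < g ^ length w" "x_word g (length w) a = w" and k: "l = X k" "k < g"
    by auto
  have "a * g + k < g ^ length w * g"
    using a k by (intro mult_add_less_mult)
  then show ?case
    using a k by (intro exI[of _ "a * g + k"]) (simp add: mult.commute)
qed simp

lemma nc_coeff_eq_0_of_nc_in_x:
  assumes "p \<in> nc_in_x g" "\<not> set w \<subseteq> X ` {..<g}"
  shows "nc_coeff p w = 0"
proof -
  have "NCWord w \<notin> Poly_Mapping.keys p" using assms by (force simp: nc_in_x_def)
  then show ?thesis by (simp add: nc_coeff_def in_keys_iff)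
qed

text \<open>The blocks with second index 0 already see all of \<open>p\<close>: any word of length
  \<open>n + 2\<close> splits into its first \<open>n + 1\<close> letters, a row of the block, and
  its last letter, a column.\<close>

lemma nc_coeff_eq_0_of_scalar_block:
  assumes p: "p \<in> nc_in_x g" and Z: "middle_matrix g p Z"
    and zero: "scalar_block Z n 0 = 0\<^sub>m (g ^ (n + 1)) (g ^ (0 + 1))"
    and w: "length w = n + 2"
  shows "nc_coeff p w = 0"
proof (cases "set w \<subseteq> X ` {..<g}")
  case True
  obtain v l where v: "w = v @ [l]" "length v = n + 1"
    using w by (cases w rule: rev_cases) auto
  obtain v' k where v': "v = v' @ [k]" "length v' = n"
    using v(2) by (cases v rule: rev_cases) auto
  obtain a where a: "a < g ^ (n + 1)" "x_word g (n + 1) a = v"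
    using x_word_surj[of v g] True v by auto
  obtain b where b: "l = X b" "b < g" using True v by auto
  \<comment> \<open>Unmarking the border word of level \<open>n\<close> at \<open>a\<close> gives
    the x word of length \<open>n + 1\<close> at the same position.\<close>
  have "map unmark (border_word g n a @ rev (border_word g 0 b)) = w"
    using a(2) b v by (simp add: border_word_def unmark_x_word)
  moreover have "scalar_block Z n 0 $$ (a, b) = 0"
    using a b by (simp add: zero)
  ultimately show ?thesis
    using scalar_block_entry[OF p Z a(1), of b 0] b by simp
next
  case False
  then show ?thesis by (rule nc_coeff_eq_0_of_nc_in_x[OF p])
qed

section \<open>Homogeneous polynomials\<close>

text \<open>The homogeneous polynomials of degree \<open>n\<close> in the variables x, with 0
  included for every \<open>n\<close>. Phrasing this by coefficients lets vanishing at all other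
  words be read off directly.\<close>

definition nc_form :: "nat \<Rightarrow> nat \<Rightarrow> ncpoly set"
  where "nc_form g n =
    {p. \<forall>w. nc_coeff p w \<noteq> 0 \<longrightarrow> set w \<subseteq> X ` {..<g} \<and> length w = n}"

lemma nc_form_coeff_eq_0:
  "p \<in> nc_form g n \<Longrightarrow> \<not> (set w \<subseteq> X ` {..<g} \<and> length w = n) \<Longrightarrow> nc_coeff p w = 0"
  by (auto simp: nc_form_def)

lemma nc_coeff_add: "nc_coeff (p + q) w = nc_coeff p w + nc_coeff q w"
  by (simp add: nc_coeff_def lookup_add)

lemma nc_coeff_sum: "nc_coeff (sum f I) w = (\<Sum>i\<in>I. nc_coeff (f i) w)"
  by (simp add: nc_coeff_def lookup_sum)

lemma nc_coeff_single:
  "nc_coeff (Poly_Mapping.single (NCWord v) c) w = (if v = w then c else 0)"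
  by (simp add: nc_coeff_def lookup_single when_def)

lemma nc_coeff_star: "nc_coeff (nc_star p) w = nc_coeff p (rev w)"
  by (simp add: nc_coeff_def lookup_nc_star)

lemma nc_coeff_hom_part: "nc_coeff (nc_hom_part j p) w = (if length w = j then nc_coeff p w else 0)"
  by (auto simp: nc_coeff_def nc_hom_part_def lookup_sum lookup_single when_def in_keys_iff)

lemma ncpoly_eqI: "(\<And>w. nc_coeff p w = nc_coeff q w) \<Longrightarrow> p = q"
  unfolding nc_coeff_def by (rule poly_mapping_eqI) (metis ncword.collapse)

lemma nc_form_0: "0 \<in> nc_form g n"
  by (simp add: nc_form_def nc_coeff_def)

lemma nc_form_add: "p \<in> nc_form g n \<Longrightarrow> q \<in> nc_form g n \<Longrightarrow> p + q \<in> nc_form g n"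
  unfolding nc_form_def nc_coeff_add mem_Collect_eq
proof (intro allI impI)
  fix w
  assume "\<forall>w. nc_coeff p w \<noteq> 0 \<longrightarrow> set w \<subseteq> X ` {..<g} \<and> length w = n"
    and "\<forall>w. nc_coeff q w \<noteq> 0 \<longrightarrow> set w \<subseteq> X ` {..<g} \<and> length w = n"
    and "nc_coeff p w + nc_coeff q w \<noteq> 0"
  then show "set w \<subseteq> X ` {..<g} \<and> length w = n"
    by (cases "nc_coeff p w = 0") simp_all
qed

lemma nc_form_sum: "(\<And>i. i \<in> I \<Longrightarrow> f i \<in> nc_form g n) \<Longrightarrow> sum f I \<in> nc_form g n"
  by (induction I rule: infinite_finite_induct) (simp_all add: nc_form_0 nc_form_add)

lemma nc_form_single:
  "set w \<subseteq> X ` {..<g} \<Longrightarrow> length w = n \<Longrightarrow> Poly_Mapping.single (NCWord w) c \<in> nc_form g n"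
  by (auto simp: nc_form_def nc_coeff_single split: if_splits)

lemma nc_form_star: "p \<in> nc_form g n \<Longrightarrow> nc_star p \<in> nc_form g n"
  unfolding nc_form_def nc_coeff_star mem_Collect_eq
proof (intro allI impI)
  fix w
  assume "\<forall>w. nc_coeff p w \<noteq> 0 \<longrightarrow> set w \<subseteq> X ` {..<g} \<and> length w = n"
    and "nc_coeff p (rev w) \<noteq> 0"
  then show "set w \<subseteq> X ` {..<g} \<and> length w = n"
    using set_rev[of w] length_rev[of w] by metis
qed

text \<open>Every key of the product is a concatenation of a key of \<open>p\<close> and a key of
  \<open>q\<close>.\<close>

lemma nc_form_mult:
  assumes "p \<in> nc_form g m" "q \<in> nc_form g n"
  shows "p * q \<in> nc_form g (m + n)"
  unfolding nc_form_def
proof (intro CollectI allI impI)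
  fix w assume "nc_coeff (p * q) w \<noteq> 0"
  then have "NCWord w \<in> Poly_Mapping.keys (p * q)" by (simp add: nc_coeff_def in_keys_iff)
  then obtain a b where ab: "NCWord w = a + b" "a \<in> Poly_Mapping.keys p" "b \<in> Poly_Mapping.keys q"
    using keys_mult[of p q] by auto
  then have "nc_coeff p (letters a) \<noteq> 0" "nc_coeff q (letters b) \<noteq> 0"
    by (simp_all add: nc_coeff_def in_keys_iff)
  moreover have "w = letters a @ letters b" using ab(1) by (simp add: plus_ncword_def)
  ultimately show "set w \<subseteq> X ` {..<g} \<and> length w = m + n"
    using assms by (simp add: nc_form_def)
qed

text \<open>The first letter of the word selects the only summand of the linear form that
  contributes.\<close>

lemma nc_coeff_linear_mult:
  assumes "a < g"
  shows "nc_coeff ((\<Sum>i<g. Poly_Mapping.single (NCWord [X i]) (c i)) * q) (X a # w) =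
    c a * nc_coeff q w"
proof -
  have "nc_coeff (Poly_Mapping.single (NCWord [X i]) (c i) * q) (X a # w) =
      (if i = a then c i * nc_coeff q w else 0)" for i
    by (auto simp: nc_coeff_def lookup_single_mult)
  then show ?thesis using assms by (simp add: sum_distrib_right nc_coeff_sum)
qed

lemma nc_coeff_mult_linear:
  assumes "a < g"
  shows "nc_coeff (q * (\<Sum>i<g. Poly_Mapping.single (NCWord [X i]) (c i))) (w @ [X a]) =
    nc_coeff q w * c a"
proof -
  have "nc_coeff (q * Poly_Mapping.single (NCWord [X i]) (c i)) (w @ [X a]) =
      (if i = a then nc_coeff q w * c i else 0)" for i
    by (auto simp: nc_coeff_def lookup_mult_single)
  then show ?thesis using assms by (simp add: sum_distrib_left nc_coeff_sum)
qed

section \<open>Entries of the prescribed blocks\<close>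

lemma index_col_mat [simp]: "i < dim_vec v \<Longrightarrow> col_mat v $$ (i, 0) = v $ i"
  by (simp add: col_mat_def mat_of_cols_index)

lemma dims_col_mat [simp]: "dim_row (col_mat v) = dim_vec v" "dim_col (col_mat v) = 1"
  by (simp_all add: col_mat_def)

lemma col_mat_times:
  assumes "B \<in> carrier_mat 1 n" "i < dim_vec v" "j < n"
  shows "(col_mat v * B) $$ (i, j) = v $ i * B $$ (0, j)"
  using assms by (simp add: scalar_prod_def)

lemma scalar_block_00_entry:
  assumes "p \<in> nc_in_x g" "middle_matrix g p Z" "k < g" "l < g"
  shows "scalar_block Z 0 0 $$ (k, l) = 2 * nc_coeff p [X k, X l]"
  using assms scalar_block_entry[OF assms(1,2), of k 0 l 0] by (simp add: border_word_def)

text \<open>Column \<open>m * g + l\<close> belongs to the border word x_m h_l, which enters V_1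
  reversed as h_l x_m; hence \<open>l\<close> comes before \<open>m\<close> in the word.\<close>

lemma scalar_block_01_entry:
  assumes "p \<in> nc_in_x g" "middle_matrix g p Z" "k < g" "l < g" "m < g"
  shows "scalar_block Z 0 1 $$ (k, m * g + l) = 2 * nc_coeff p [X k, X l, X m]"
  using assms scalar_block_entry[OF assms(1,2), of k 0 "m * g + l" 1]
  by (simp add: border_word_def mult_add_less_mult)

lemma scalar_block_11_entry:
  assumes "p \<in> nc_in_x g" "middle_matrix g p Z" "i < g" "k < g" "l < g" "m < g"
  shows "scalar_block Z 1 1 $$ (i * g + k, m * g + l) = 2 * nc_coeff p [X i, X k, X l, X m]"
  using assms scalar_block_entry[OF assms(1,2), of "i * g + k" 1 "m * g + l" 1]
  by (simp add: border_word_def mult_add_less_mult)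

lemma S01_entry:
  assumes "u \<in> carrier_vec g" "y \<in> carrier_vec g" "v \<in> carrier_vec (g\<^sup>2)"
    and klm: "k < g" "l < g" "m < g"
  shows "(col_mat u * kron (transpose_mat (col_mat u)) (transpose_mat (col_mat y))
      + col_mat u * transpose_mat (col_mat v)
      + struct_transpose g (col_mat u * transpose_mat (col_mat v))) $$ (k, m * g + l) =
    (u $ k * u $ m * y $ l + u $ k * v $ (m * g + l) + u $ m * v $ (k * g + l) :: real)"
proof -
  have lt: "m * g + l < g * g" "k * g + l < g * g"
    using klm by (simp_all add: mult_add_less_mult)
  have 1: "(col_mat u * kron (transpose_mat (col_mat u)) (transpose_mat (col_mat y))) $$ (k, m * g + l) =
      u $ k * (u $ m * y $ l)"
    using assms lt by (subst col_mat_times[where n = "g * g"]) (auto simp: kron_def)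
  have 2: "(col_mat u * transpose_mat (col_mat v)) $$ (i, j) = u $ i * v $ j"
    if "i < g" "j < g * g" for i j
    using assms that by (subst col_mat_times[where n = "g * g"]) (auto simp: power2_eq_square)
  \<comment> \<open>The structured transpose exchanges the row index \<open>k\<close> with the block
    index \<open>m\<close> and keeps the position \<open>l\<close> inside the block.\<close>
  have 3: "struct_transpose g (col_mat u * transpose_mat (col_mat v)) $$ (k, m * g + l) =
      u $ m * v $ (k * g + l)"
    using klm lt by (simp add: struct_transpose_def 2 power2_eq_square)
  have add: "(B + C + D) $$ (k, m * g + l) = B $$ (k, m * g + l) + C $$ (k, m * g + l) + D $$ (k, m * g + l)"
    if "B \<in> carrier_mat g (g * g)" "C \<in> carrier_mat g (g * g)" "D \<in> carrier_mat g (g * g)"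
    for B C D :: "real mat"
    using that klm lt by simp
  show ?thesis
    using assms lt by (subst add; (simp only: 1 2 3)?)
      (auto simp: kron_def struct_transpose_def power2_eq_square)
qed

text \<open>Row \<open>i * g + k\<close> of the Kronecker product of u with the identity can be
  nonzero only in column \<open>k\<close>, where it is u_i. Both matrix products thus reduce to one
  summand.\<close>

lemma S11_entry:
  assumes "u \<in> carrier_vec g" "A \<in> carrier_mat g g" "i < g" "k < g" "l < g" "m < g"
  shows "(kron (col_mat u) (1\<^sub>m g) * A * transpose_mat (kron (col_mat u) (1\<^sub>m g)))
      $$ (i * g + k, m * g + l) = (u $ i * A $$ (k, l) * u $ m :: real)"
proof -
  let ?K = "kron (col_mat u) (1\<^sub>m g)"
  have K: "?K \<in> carrier_mat (g * g) g"
    using assms by (auto simp: kron_def)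
  have entry: "?K $$ (i * g + k, c) = (if c = k then u $ i else 0)"
    if "i < g" "k < g" "c < g" for i k c
    using assms(1) that by (auto simp: kron_def mult_add_less_mult)
  have lt: "i * g + k < g * g" "m * g + l < g * g"
    using assms by (simp_all add: mult_add_less_mult)
  have KA: "(?K * A) $$ (i * g + k, c) = u $ i * A $$ (k, c)" if "c < g" for c
  proof -
    have "(?K * A) $$ (i * g + k, c) = (\<Sum>d<g. ?K $$ (i * g + k, d) * A $$ (d, c))"
      using K assms that lt by (simp add: scalar_prod_def atLeast0LessThan)
    also have "\<dots> = (\<Sum>d<g. if d = k then u $ i * A $$ (d, c) else 0)"
      using assms by (intro sum.cong) (auto simp: entry)
    finally show ?thesis using assms by simp
  qed
  have "(?K * A * transpose_mat ?K) $$ (i * g + k, m * g + l) =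
      (\<Sum>c<g. (?K * A) $$ (i * g + k, c) * ?K $$ (m * g + l, c))"
    using K assms lt by (subst index_mult_mat) (auto simp: scalar_prod_def atLeast0LessThan)
  also have "\<dots> = (\<Sum>c<g. if c = l then u $ i * A $$ (k, c) * u $ m else 0)"
    using assms by (intro sum.cong) (auto simp: entry KA)
  finally show ?thesis using assms by simp
qed

section \<open>The linear and quadratic polynomials\<close>

lemma linear_poly_eq:
  assumes "u \<in> carrier_vec g"
  shows "(x_row g * nc_mat (col_mat u)) $$ (0, 0) =
    (\<Sum>i<g. Poly_Mapping.single (NCWord [X i]) (u $ i))"
  using assms x_row_carrier[of g]
  by (auto simp: scalar_prod_def atLeast0LessThan nc_mat_def x_row_entry nc_const_def mult_single
      intro!: sum.cong)

lemma quadratic_row_eq: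
  assumes "c \<in> carrier_mat 1 (g\<^sup>2)"
  shows "(nc_mat c * nc_adjoint (kron_pow (x_row g) 2)) $$ (0, 0) =
    (\<Sum>a<g\<^sup>2. Poly_Mapping.single (NCWord (rev (x_word g 2 a))) (c $$ (0, a)))"
proof -
  have K: "kron_pow (x_row g) 2 \<in> carrier_mat 1 (g\<^sup>2)" by (rule kron_pow_x_row_carrier)
  have "(nc_mat c * nc_adjoint (kron_pow (x_row g) 2)) $$ (0, 0) =
      (\<Sum>a<g\<^sup>2. nc_const (c $$ (0, a)) * nc_star (kron_pow (x_row g) 2 $$ (0, a)))"
    using assms K by (auto simp: scalar_prod_def atLeast0LessThan nc_mat_def nc_adjoint_def
        simp del: kron_pow.simps intro!: sum.cong)
  then show ?thesis
    by (simp add: kron_pow_x_row nc_star_single nc_const_def mult_single del: x_word.simps)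
qed

text \<open>The column of words is reversed, so x_i x_j stands at the lexicographic position of x_j
  x_i, which is \<open>j * g + i\<close>.\<close>

lemma nc_coeff_quadratic_row:
  assumes "i < g" "j < g"
  shows "nc_coeff (\<Sum>a<g\<^sup>2. Poly_Mapping.single (NCWord (rev (x_word g 2 a))) (c a)) [X i, X j] =
    c (j * g + i)"
proof -
  have lt: "j * g + i < g\<^sup>2" using assms by (simp add: mult_add_less_mult power2_eq_square)
  have w: "x_word g 2 (j * g + i) = [X j, X i]"
    using assms by (simp add: numeral_2_eq_2)
  have "(rev (x_word g 2 a) = [X i, X j]) = (a = j * g + i)" if "a < g\<^sup>2" for a
    using x_word_inject[OF that lt] w by auto
  then have "nc_coeff (\<Sum>a<g\<^sup>2. Poly_Mapping.single (NCWord (rev (x_word g 2 a))) (c a)) [X i, X j] =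
      (\<Sum>a<g\<^sup>2. if a = j * g + i then c a else 0)"
    by (simp add: nc_coeff_sum nc_coeff_single)
  then show ?thesis using lt by simp
qed

lemma quadratic_form_eq:
  assumes "A \<in> carrier_mat g g"
  shows "(x_row g * nc_mat A * nc_adjoint (x_row g)) $$ (0, 0) =
    (\<Sum>b<g. \<Sum>a<g. Poly_Mapping.single (NCWord [X a, X b]) (A $$ (a, b)))"
proof -
  have "nc_mat A \<in> carrier_mat g g" "nc_adjoint (x_row g) \<in> carrier_mat g 1"
    using assms x_row_carrier[of g] by (auto simp: nc_mat_def nc_adjoint_def)
  from sandwich_entry[OF x_row_carrier this] show ?thesis
    using assms x_row_carrier[of g]
    by (auto simp: nc_mat_def nc_adjoint_def x_row_entry nc_star_single nc_const_def mult_single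
        plus_NCWord zero_ncword_def intro!: sum.cong)
qed

lemma nc_coeff_quadratic_form:
  assumes "i < g" "j < g"
  shows "nc_coeff (\<Sum>b<g. \<Sum>a<g. Poly_Mapping.single (NCWord [X a, X b]) (c a b)) [X i, X j] = c i j"
proof -
  have "nc_coeff (\<Sum>b<g. \<Sum>a<g. Poly_Mapping.single (NCWord [X a, X b]) (c a b)) [X i, X j] =
      (\<Sum>b<g. \<Sum>a<g. if a = i then if b = j then c a b else 0 else 0)"
    unfolding nc_coeff_sum nc_coeff_single by (intro sum.cong) auto
  then show ?thesis using assms by simp
qed

section \<open>The decomposition\<close>

text \<open>Scaling a matrix scales its quadratic form. The factor used below is 1/2.\<close>

lemma psd_smult:
  assumes "psd M" "0 \<le> c"
  shows "psd (c \<cdot>\<^sub>m M)"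
proof -
  define n where "n = dim_row M"
  have M: "M \<in> carrier_mat n n" "transpose_mat M = M"
    and nonneg: "\<And>z. z \<in> carrier_vec n \<Longrightarrow> 0 \<le> z \<bullet> (M *\<^sub>v z)"
    using assms(1) by (auto simp: psd_def n_def)
  have "transpose_mat (c \<cdot>\<^sub>m M) = c \<cdot>\<^sub>m transpose_mat M"
    by (rule eq_matI) auto
  moreover have "z \<bullet> (c \<cdot>\<^sub>m M *\<^sub>v z) = c * (z \<bullet> (M *\<^sub>v z))" if "z \<in> carrier_vec n" for z
  proof -
    have "c \<cdot>\<^sub>m M *\<^sub>v z = c \<cdot>\<^sub>v (M *\<^sub>v z)"
      using M(1) that by (intro eq_vecI) (auto simp: scalar_prod_def sum_distrib_left mult.assoc)
    then show ?thesis using M(1) that by simp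
  qed
  ultimately show ?thesis
    using M nonneg assms(2) by (simp add: psd_def)
qed

theorem theorem1p11:
  fixes g :: nat and p \<phi> q f0 :: ncpoly
    and Z :: "nat \<Rightarrow> nat \<Rightarrow> ncpoly mat" and S :: "nat \<Rightarrow> nat \<Rightarrow> real mat"
    and u y v :: "real vec" and A P :: "real mat"
  assumes p: "p \<in> nc_in_x g" "nc_star p = p" "nc_degree p \<ge> 3"
    and Z: "middle_matrix g p Z"
    and S: "S = scalar_block Z"
    and mu: "mu_minus (scalar_middle_matrix g (nc_degree p) Z) = 1"
    and u: "u \<in> carrier_vec g" "sqrt (scalar_prod u u) = 1"
    and y: "y \<in> carrier_vec g"
    and v: "v \<in> carrier_vec (g\<^sup>2)" "mat_op g v *\<^sub>v u = 0\<^sub>v g"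
    and A: "A \<in> carrier_mat g g" "transpose_mat A = A"
    and S_zero: "\<And>i j. i + j \<ge> 3 \<Longrightarrow> S i j = 0\<^sub>m (g ^ (i + 1)) (g ^ (j + 1))"
    and S01: "S 0 1 =
      col_mat u * kron (transpose_mat (col_mat u)) (transpose_mat (col_mat y))
      + col_mat u * transpose_mat (col_mat v)
      + struct_transpose g (col_mat u * transpose_mat (col_mat v))"
    and S11: "S 1 1 =
      kron (col_mat u) (1\<^sub>m g) * A * transpose_mat (kron (col_mat u) (1\<^sub>m g))"
    and S02: "S 0 2 =
      col_mat u * kron (transpose_mat (col_mat u)) (transpose_mat (col_mat (vec_op A)))"
    and P: "P = 1\<^sub>m g - col_mat u * transpose_mat (col_mat u)"
    and psd: "psd (four_block_mat (P * S 0 0 * P) (transpose_mat (mat_op g v)) (mat_op g v) A)"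
    and \<phi>: "\<phi> = (x_row g * nc_mat (col_mat u)) $$ (0, 0)"
    and q: "q = (nc_mat ((1 / 4) \<cdot>\<^sub>m
                   transpose_mat (kron (col_mat u) (col_mat y) + 2 \<cdot>\<^sub>m col_mat v))
                 * nc_adjoint (kron_pow (x_row g) 2)) $$ (0, 0)"
    and f0: "f0 = nc_const (1 / 2) *
                 (x_row g * nc_mat A * nc_adjoint (x_row g)) $$ (0, 0)"
  shows "p = nc_hom_part 0 p + nc_hom_part 1 p + nc_hom_part 2 p
             + \<phi> * q + nc_star q * \<phi> + \<phi> * f0 * \<phi>
         \<and> psd (four_block_mat
              (P * Q_mat g (nc_hom_part 2 p) * P) (P * transpose_mat (Q_mat g q))
              (Q_mat g q * P) (Q_mat g f0))"
proof

  \<comment> \<open>Coefficients and homogeneity of \<phi>, q and f_0\<close>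
  define c where "c = (1 / 4) \<cdot>\<^sub>m transpose_mat (kron (col_mat u) (col_mat y) + 2 \<cdot>\<^sub>m col_mat v)"
  have c_carrier: "c \<in> carrier_mat 1 (g\<^sup>2)"
    using u(1) y v(1) by (auto simp: c_def kron_def power2_eq_square)
  have c_entry: "c $$ (0, i * g + j) = (u $ i * y $ j + 2 * v $ (i * g + j)) / 4"
    if "i < g" "j < g" for i j
    using u(1) y v(1) that mult_add_less_mult[of i g j g]
    by (simp add: c_def kron_def power2_eq_square)

  have \<phi>_eq: "\<phi> = (\<Sum>i<g. Poly_Mapping.single (NCWord [X i]) (u $ i))"
    unfolding \<phi> by (rule linear_poly_eq[OF u(1)])
  have q_eq: "q = (\<Sum>a<g\<^sup>2. Poly_Mapping.single (NCWord (rev (x_word g 2 a))) (c $$ (0, a)))"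
    unfolding q c_def[symmetric] by (rule quadratic_row_eq[OF c_carrier])
  have f0_eq: "f0 = (\<Sum>b<g. \<Sum>a<g. Poly_Mapping.single (NCWord [X a, X b]) (A $$ (a, b) / 2))"
    unfolding f0 quadratic_form_eq[OF A(1)] by (simp add: sum_distrib_left nc_const_def mult_single)

  have q_coeff: "nc_coeff q [X i, X j] = (u $ j * y $ i + 2 * v $ (j * g + i)) / 4"
    if "i < g" "j < g" for i j
    using that by (simp add: q_eq nc_coeff_quadratic_row c_entry)
  have f0_coeff: "nc_coeff f0 [X i, X j] = A $$ (i, j) / 2" if "i < g" "j < g" for i j
    using that by (simp add: f0_eq nc_coeff_quadratic_form)

  have \<phi>_form: "\<phi> \<in> nc_form g 1"
    unfolding \<phi>_eq by (auto intro!: nc_form_sum nc_form_single)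
  have "set (x_word g 2 a) \<subseteq> X ` {..<g}" if "a < g\<^sup>2" for a
  proof -
    have "0 < g" using that by (cases g) auto
    then show ?thesis by (auto simp: numeral_2_eq_2)
  qed
  then have q_form: "q \<in> nc_form g 2"
    unfolding q_eq by (intro nc_form_sum nc_form_single) (auto simp: length_x_word)
  have f0_form: "f0 \<in> nc_form g 2"
    unfolding f0_eq by (auto intro!: nc_form_sum nc_form_single)
  have forms: "\<phi> * q \<in> nc_form g 3" "nc_star q * \<phi> \<in> nc_form g 3" "\<phi> * f0 * \<phi> \<in> nc_form g 4"
    using nc_form_mult[OF \<phi>_form q_form] nc_form_mult[OF nc_form_star[OF q_form] \<phi>_form]
      nc_form_mult[OF nc_form_mult[OF \<phi>_form f0_form] \<phi>_form]
    by (simp_all add: eval_nat_numeral)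
  \<comment> \<open>Each product has no coefficient at words of the wrong length or with foreign
    letters.\<close>
  note zero = forms[THEN nc_form_coeff_eq_0]

  \<comment> \<open>Cubic and quartic coefficients\<close>
  have coeff3: "nc_coeff p [X k, X l, X m] =
      nc_coeff (\<phi> * q) [X k, X l, X m] + nc_coeff (nc_star q * \<phi>) [X k, X l, X m]"
    if "k < g" "l < g" "m < g" for k l m
  proof -
    have "nc_coeff (\<phi> * q) [X k, X l, X m] = u $ k * nc_coeff q [X l, X m]"
      unfolding \<phi>_eq by (rule nc_coeff_linear_mult[OF that(1)])
    moreover have "nc_coeff (nc_star q * \<phi>) ([X k, X l] @ [X m]) = nc_coeff (nc_star q) [X k, X l] * u $ m"
      unfolding \<phi>_eq by (rule nc_coeff_mult_linear[OF that(3)])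
    moreover have "2 * nc_coeff p [X k, X l, X m] =
        u $ k * u $ m * y $ l + u $ k * v $ (m * g + l) + u $ m * v $ (k * g + l)"
      using S01_entry[OF u(1) y v(1) that] scalar_block_01_entry[OF p(1) Z that] S S01 by simp
    \<comment> \<open>The two products contribute u_k q_lm and q_lk u_m. Their y terms are a quarter
      each and add up to half of the y term of Z_01; their v terms are half of its other two
      terms.\<close>
    ultimately show ?thesis
      using that by (simp add: q_coeff nc_coeff_star field_simps)
  qed
  have coeff4: "nc_coeff p [X i, X k, X l, X m] = nc_coeff (\<phi> * f0 * \<phi>) [X i, X k, X l, X m]"
    if "i < g" "k < g" "l < g" "m < g" for i k l m
  proof -
    have "nc_coeff (\<phi> * f0 * \<phi>) ([X i, X k, X l] @ [X m]) = nc_coeff (\<phi> * f0) [X i, X k, X l] * u $ m"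
      \<comment> \<open>Only the right factor \<phi> is expanded, so that the last letter can be
        split off.\<close>
      by (subst (2) \<phi>_eq) (rule nc_coeff_mult_linear[OF that(4)])
    moreover have "nc_coeff (\<phi> * f0) [X i, X k, X l] = u $ i * nc_coeff f0 [X k, X l]"
      unfolding \<phi>_eq by (rule nc_coeff_linear_mult[OF that(1)])
    moreover have "2 * nc_coeff p [X i, X k, X l, X m] = u $ i * A $$ (k, l) * u $ m"
      using S11_entry[OF u(1) A(1) that] scalar_block_11_entry[OF p(1) Z that] S S11 by simp
    ultimately show ?thesis
      using that by (simp add: f0_coeff)
  qed

  \<comment> \<open>Comparison of coefficients by word length\<close>
  show "p = nc_hom_part 0 p + nc_hom_part 1 p + nc_hom_part 2 p
             + \<phi> * q + nc_star q * \<phi> + \<phi> * f0 * \<phi>"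
  proof (rule ncpoly_eqI)
    fix w
    have "nc_coeff p w = (if length w \<le> 2 then nc_coeff p w else 0) + nc_coeff (\<phi> * q) w
        + nc_coeff (nc_star q * \<phi>) w + nc_coeff (\<phi> * f0 * \<phi>) w"
    proof (cases "set w \<subseteq> X ` {..<g}")
      case False
      then show ?thesis by (simp add: zero nc_coeff_eq_0_of_nc_in_x[OF p(1)])
    next
      case True
      consider "length w \<le> 2" | "length w = 3" | "length w = 4" | "length w \<ge> 5" by linarith
      then show ?thesis
      proof cases
        case 2
        then obtain k l m where w: "w = [X k, X l, X m]" "k < g" "l < g" "m < g"
          using True by (auto simp: numeral_3_eq_3 length_Suc_conv)
        then show ?thesis
          using coeff3[of k l m] zero(3)[of w] by simp
      next
        case 3
        then have "length w = Suc (Suc (Suc (Suc 0)))" by simp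
        then obtain i k l m where w: "w = [X i, X k, X l, X m]" "i < g" "k < g" "l < g" "m < g"
          using True by (auto simp: length_Suc_conv)
        then show ?thesis
          using coeff4[of i k l m] zero(1,2)[of w] by simp
      next
        case 4
        \<comment> \<open>For length at least 5 the block with indices \<open>length w - 2\<close>
          and 0 has index sum at least 3, so it is zero.\<close>
        then have "nc_coeff p w = 0"
          using S_zero[of "length w - 2" 0] S
          by (intro nc_coeff_eq_0_of_scalar_block[OF p(1) Z, of "length w - 2"]) auto
        then show ?thesis using 4 by (simp add: zero)
      qed (simp add: zero)
    qed
    moreover have "length w \<le> 2 \<longleftrightarrow> length w = 0 \<or> length w = 1 \<or> length w = 2" by linarith
    ultimately show "nc_coeff p w = nc_coeff (nc_hom_part 0 p + nc_hom_part 1 p + nc_hom_part 2 p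
             + \<phi> * q + nc_star q * \<phi> + \<phi> * f0 * \<phi>) w"
      by (auto simp: nc_coeff_add nc_coeff_hom_part)
  qed

  \<comment> \<open>The projection P and the second block matrix\<close>
  have P_carrier: "P \<in> carrier_mat g g" 
    unfolding P using u(1) by (intro minus_carrier_mat carrier_matI) auto
  have P_entry: "P $$ (i, j) = (if i = j then 1 else 0) - u $ i * u $ j" if "i < g" "j < g" for i j
  proof -
    have "(col_mat u * transpose_mat (col_mat u)) $$ (i, j) = u $ i * u $ j"
      using u(1) that by (subst col_mat_times[where n = g]) auto
    then show ?thesis
      using u(1) that unfolding P by (subst index_minus_mat) auto
  qed
  have P_sym: "transpose_mat P = P"
    using P_carrier by (intro eq_matI) (auto simp: P_entry)
  have mat_op_carrier: "mat_op g v \<in> carrier_mat g g"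
    \<comment> \<open>The number of columns is \<open>g\<^sup>2 div g\<close>; for
      \<open>g = 0\<close> this is 0 because division by zero gives 0.\<close>
    using v(1) by (cases "g = 0") (auto simp: mat_op_def power2_eq_square)
  have mat_op_entry: "mat_op g v $$ (i, j) = v $ (j * g + i)" if "i < g" "j < g" for i j
    using v(1) that by (auto simp: mat_op_def power2_eq_square)
  have uu: "(\<Sum>k<g. u $ k * u $ k) = 1"
    using u by (simp add: scalar_prod_def atLeast0LessThan)
  have vu: "(\<Sum>k<g. v $ (k * g + i) * u $ k) = 0" if "i < g" for i
  proof -
    have "(\<Sum>k<g. v $ (k * g + i) * u $ k) = (mat_op g v *\<^sub>v u) $ i"
      using that u(1) mat_op_carrier by (simp add: scalar_prod_def atLeast0LessThan mat_op_entry)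
    then show ?thesis using v(2) that by simp
  qed

  have Qq_carrier: "Q_mat g q \<in> carrier_mat g g" by (simp add: Q_mat_def)
  \<comment> \<open>The factor 1/2 undoes the 2 in the entries of the scalar middle matrix.\<close>
  have Qp: "Q_mat g (nc_hom_part 2 p) = (1 / 2) \<cdot>\<^sub>m S 0 0"
    and S00_carrier: "S 0 0 \<in> carrier_mat g g"
  proof -
    have "Z 0 0 \<in> carrier_mat (g ^ (0 + 1)) (g ^ (0 + 1))"
      using Z unfolding middle_matrix_def by blast
    then show "S 0 0 \<in> carrier_mat g g"
      by (simp add: S scalar_block_def)
    then show "Q_mat g (nc_hom_part 2 p) = (1 / 2) \<cdot>\<^sub>m S 0 0"
      by (intro eq_matI) (auto simp: Q_mat_def nc_coeff_hom_part S scalar_block_00_entry[OF p(1) Z])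
  qed
  have "P * Q_mat g (nc_hom_part 2 p) * P = (1 / 2) \<cdot>\<^sub>m (P * S 0 0 * P)"
    using P_carrier S00_carrier
    by (simp add: Qp mult_smult_distrib[of _ g g _ g] mult_smult_assoc_mat[of _ g g _ g])
  \<comment> \<open>By \<open>q_coeff\<close>, Q(q) = y u^T / 4 + mat_g v / 2. Hence Q(q) u = y / 4,
    and subtracting (Q(q) u) u^T removes exactly the first term.\<close>
  moreover have QqP: "Q_mat g q * P = (1 / 2) \<cdot>\<^sub>m mat_op g v"
  proof (rule eq_matI)
    fix i j assume "i < dim_row ((1 / 2) \<cdot>\<^sub>m mat_op g v)" "j < dim_col ((1 / 2) \<cdot>\<^sub>m mat_op g v)"
    then have ij: "i < g" "j < g" using mat_op_carrier by auto
    have "(\<Sum>k<g. nc_coeff q [X i, X k] * u $ k) =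
        (\<Sum>k<g. y $ i / 4 * (u $ k * u $ k) + 1 / 2 * (v $ (k * g + i) * u $ k))"
      using ij by (intro sum.cong) (auto simp: q_coeff field_simps)
    also have "\<dots> = y $ i / 4"
      using ij by (simp only: sum.distrib flip: sum_distrib_left) (simp add: uu vu)
    finally have Qu: "(\<Sum>k<g. nc_coeff q [X i, X k] * u $ k) = y $ i / 4" .
    have "(Q_mat g q * P) $$ (i, j) = (\<Sum>k<g. nc_coeff q [X i, X k] * P $$ (k, j))"
      using ij P_carrier by (simp add: scalar_prod_def atLeast0LessThan Q_mat_def)
    also have "\<dots> = (\<Sum>k<g. (if k = j then nc_coeff q [X i, X k] else 0)
        - nc_coeff q [X i, X k] * u $ k * u $ j)"
      using ij by (intro sum.cong) (auto simp: P_entry algebra_simps)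
    also have "\<dots> = nc_coeff q [X i, X j] - y $ i / 4 * u $ j"
      using ij by (simp add: sum_subtractf Qu flip: sum_distrib_right)
    finally show "(Q_mat g q * P) $$ (i, j) = ((1 / 2) \<cdot>\<^sub>m mat_op g v) $$ (i, j)"
      using ij mat_op_carrier by (simp add: q_coeff mat_op_entry field_simps)
  qed (use mat_op_carrier P_carrier in \<open>auto simp: Q_mat_def\<close>)
  moreover have "P * transpose_mat (Q_mat g q) = (1 / 2) \<cdot>\<^sub>m transpose_mat (mat_op g v)"
  proof -
    \<comment> \<open>Since P is symmetric, the upper right block is the transpose of the lower left
      one.\<close>
    have "P * transpose_mat (Q_mat g q) = transpose_mat (Q_mat g q * P)"
      by (simp add: transpose_mult[OF Qq_carrier P_carrier] P_sym)
    also have "\<dots> = (1 / 2) \<cdot>\<^sub>m transpose_mat (mat_op g v)"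
      unfolding QqP by (rule eq_matI) auto
    finally show ?thesis .
  qed
  moreover have "Q_mat g f0 = (1 / 2) \<cdot>\<^sub>m A"
    using A(1) by (intro eq_matI) (auto simp: Q_mat_def f0_coeff)
  \<comment> \<open>All four blocks carry the same factor, so it can be taken out of the block
    matrix.\<close>
  moreover have "(1 / 2) \<cdot>\<^sub>m four_block_mat (P * S 0 0 * P) (transpose_mat (mat_op g v)) (mat_op g v) A =
      four_block_mat ((1 / 2) \<cdot>\<^sub>m (P * S 0 0 * P)) ((1 / 2) \<cdot>\<^sub>m transpose_mat (mat_op g v))
        ((1 / 2) \<cdot>\<^sub>m mat_op g v) ((1 / 2) \<cdot>\<^sub>m A)"
    using P_carrier S00_carrier mat_op_carrier A(1) by (intro smult_four_block_mat[of _ g g _ g _ g]) auto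
  ultimately show "psd (four_block_mat
              (P * Q_mat g (nc_hom_part 2 p) * P) (P * transpose_mat (Q_mat g q))
              (Q_mat g q * P) (Q_mat g f0))"
    using psd_smult[OF psd, of "1 / 2"] by simp
qed

end
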